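(* Let $\mathcal{F}$ be a one-dimensional singular holomorphic foliation on $\mathbb{P}^2$, and let $D\subset\mathbb{P}^2$ be an irreducible algebraic solution of $\mathcal{F}$. If $D$ has a singular point, then the degree of $D$ is at least three.
   Context: An irreducible algebraic solution of $\mathcal{F}$ is an irreducible (reduced) algebraic curve $D\subset\mathbb{P}^2$ that is invariant by $\mathcal{F}$, i.e. the local vector fields defining $\mathcal{F}$ preserve the ideal sheaf of $D$. *)

theory Defs
  imports
    "HOL-Analysis.Analysis"
    "HOL-Library.Poly_Mapping"
    "HOL-Computational_Algebra.Factorial_Ring"
begin

section \<open>The complex projective plane\<close>

definition proj_rel :: "complex^3 \<Rightarrow> complex^3 \<Rightarrow> bool" where
  "proj_rel x y \<longleftrightarrow> x \<noteq> 0 \<and> y \<noteq> 0 \<and> (\<exists>c. y = c *s x)"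

lemma part_equivp_proj_rel: "part_equivp proj_rel"
proof (rule part_equivpI)
  have "(1 :: complex^3) = 1 *s 1" by (simp add: vec_eq_iff)
  then have "proj_rel 1 1" unfolding proj_rel_def using zero_neq_one by metis
  then show "\<exists>x. proj_rel x x" by blast
  show "symp proj_rel"
  proof (rule sympI)
    fix x y assume "proj_rel x y"
    then obtain c where c: "x \<noteq> 0" "y \<noteq> 0" "y = c *s x" by (auto simp: proj_rel_def)
    then have "c \<noteq> 0" by auto
    then have "x = inverse c *s y" unfolding c(3) by (simp add: vector_smult_assoc)
    then show "proj_rel y x" unfolding proj_rel_def using c(1,2) by blast
  qed
  show "transp proj_rel"
  proof (rule transpI)
    fix x y z assume "proj_rel x y" "proj_rel y z"
    then obtain c d where "x \<noteq> 0" "z \<noteq> 0" "y = c *s x" "z = d *s y"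
      by (auto simp: proj_rel_def)
    then have "x \<noteq> 0" "z \<noteq> 0" "z = (d * c) *s x" by (simp_all add: vector_smult_assoc)
    then show "proj_rel x z" unfolding proj_rel_def by blast
  qed
qed

quotient_type cp2 = "complex^3" / partial: proj_rel
  by (rule part_equivp_proj_rel)

instantiation cp2 :: topological_space
begin

definition open_cp2 :: "cp2 set \<Rightarrow> bool" where
  "open_cp2 U \<longleftrightarrow> open {x. x \<noteq> 0 \<and> abs_cp2 x \<in> U}"

instance
proof
  have "{x::complex^3. x \<noteq> 0} = - {0}" by auto
  then show "open (UNIV :: cp2 set)" by (simp add: open_cp2_def open_Compl)
next
  fix S T :: "cp2 set" assume "open S" "open T"
  then have "open ({x. x \<noteq> 0 \<and> abs_cp2 x \<in> S} \<inter> {x. x \<noteq> 0 \<and> abs_cp2 x \<in> T})"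
    by (auto simp: open_cp2_def)
  moreover have "{x. x \<noteq> 0 \<and> abs_cp2 x \<in> S} \<inter> {x. x \<noteq> 0 \<and> abs_cp2 x \<in> T}
      = {x. x \<noteq> 0 \<and> abs_cp2 x \<in> S \<inter> T}" by auto
  ultimately show "open (S \<inter> T)" by (simp add: open_cp2_def)
next
  fix K :: "cp2 set set" assume "\<forall>S\<in>K. open S"
  then have "open (\<Union>S\<in>K. {x. x \<noteq> 0 \<and> abs_cp2 x \<in> S})"
    by (intro open_UN) (auto simp: open_cp2_def)
  moreover have "(\<Union>S\<in>K. {x. x \<noteq> 0 \<and> abs_cp2 x \<in> S}) = {x. x \<noteq> 0 \<and> abs_cp2 x \<in> \<Union>K}" by auto
  ultimately show "open (\<Union>K)" by (simp add: open_cp2_def)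
qed

end

text \<open>The parametrization of the standard affine open set, on which the k-th homogeneous
  coordinate does not vanish, and its inverse.\<close>

definition affine_chart :: "3 \<Rightarrow> complex^2 \<Rightarrow> cp2" where
  "affine_chart k z = abs_cp2
     (if k = 1 then vector [1, z$1, z$2]
      else if k = 2 then vector [z$1, 1, z$2]
      else vector [z$1, z$2, 1])"

definition affine_coords :: "3 \<Rightarrow> cp2 \<Rightarrow> complex^2" where
  "affine_coords k = inv (affine_chart k)"

definition transition :: "3 \<Rightarrow> 3 \<Rightarrow> complex^2 \<Rightarrow> complex^2" where
  "transition k l = affine_coords l \<circ> affine_chart k"

section \<open>Holomorphic functions and holomorphic vector fields\<close>

text \<open>Meant for open sets: complex differentiability at every point.\<close>

definition holomorphic_C2 :: "(complex^2 \<Rightarrow> complex) \<Rightarrow> (complex^2) set \<Rightarrow> bool" where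
  "holomorphic_C2 f S \<longleftrightarrow>
     (\<forall>z\<in>S. \<exists>f'. (f has_derivative f') (at z) \<and> (\<forall>c h. f' (c *s h) = c * f' h))"

definition holomorphic_P2 :: "(cp2 \<Rightarrow> complex) \<Rightarrow> cp2 set \<Rightarrow> bool" where
  "holomorphic_P2 f U \<longleftrightarrow> (\<forall>k. holomorphic_C2 (f \<circ> affine_chart k) (affine_chart k -` U))"

text \<open>A vector field is given by its components in the three affine charts: \<open>X k p\<close> is the
  component vector at \<open>p\<close> with respect to the coordinates of chart \<open>k\<close>, and is meaningful only for
  \<open>p \<in> range (affine_chart k)\<close>.  On overlaps the components transform by the
  Jacobian of the coordinate change.\<close>

type_synonym vector_field = "3 \<Rightarrow> cp2 \<Rightarrow> complex^2"

definition holomorphic_vector_field :: "vector_field \<Rightarrow> cp2 set \<Rightarrow> bool" where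
  "holomorphic_vector_field X U \<longleftrightarrow>
     (\<forall>k i. holomorphic_C2 (\<lambda>z. X k (affine_chart k z) $ i) (affine_chart k -` U)) \<and>
     (\<forall>k l. \<forall>p \<in> U \<inter> range (affine_chart k) \<inter> range (affine_chart l).
        X l p = frechet_derivative (transition k l) (at (affine_coords k p)) (X k p))"

definition vf_zeros :: "vector_field \<Rightarrow> cp2 set \<Rightarrow> cp2 set" where
  "vf_zeros X U = {p \<in> U. \<forall>k. p \<in> range (affine_chart k) \<longrightarrow> X k p = 0}"

text \<open>The derivative \<open>X(f)\<close> of a function along a vector field. By the transformation rule and the
  chain rule it does not depend on the chart chosen around \<open>p\<close>.\<close>

definition vf_apply :: "vector_field \<Rightarrow> (cp2 \<Rightarrow> complex) \<Rightarrow> cp2 \<Rightarrow> complex" where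
  "vf_apply X f p =
     (let k = (SOME k. p \<in> range (affine_chart k))
      in frechet_derivative (f \<circ> affine_chart k) (at (affine_coords k p)) (X k p))"

section \<open>Foliations\<close>

text \<open>A one-dimensional singular holomorphic foliation is given by an open cover with a
  holomorphic vector field on each member, any two being proportional on the overlap by a nowhere
  vanishing holomorphic factor. As usual the singular set has codimension at least two, which on a
  surface means that the zeros of the local vector fields are isolated.\<close>

definition foliation :: "(cp2 set \<times> vector_field) set \<Rightarrow> bool" where
  "foliation \<F> \<longleftrightarrow>
     (\<Union>(U, X)\<in>\<F>. U) = UNIV \<and>
     (\<forall>(U, X)\<in>\<F>. open U \<and> holomorphic_vector_field X U \<and>
        (\<forall>p\<in>U. \<not> p islimpt vf_zeros X U)) \<and>
     (\<forall>(U, X)\<in>\<F>. \<forall>(V, Y)\<in>\<F>. \<exists>g. holomorphic_P2 g (U \<inter> V) \<and>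
        (\<forall>p \<in> U \<inter> V. g p \<noteq> 0) \<and>
        (\<forall>k. \<forall>p \<in> U \<inter> V \<inter> range (affine_chart k). X k p = g p *s Y k p))"

section \<open>Plane algebraic curves\<close>

text \<open>Polynomials in the three homogeneous coordinates.\<close>

type_synonym poly3 = "(3 \<Rightarrow>\<^sub>0 nat) \<Rightarrow>\<^sub>0 complex"

definition monom_degree :: "(3 \<Rightarrow>\<^sub>0 nat) \<Rightarrow> nat" where
  "monom_degree m = (\<Sum>i\<in>UNIV. Poly_Mapping.lookup m i)"

definition total_degree :: "poly3 \<Rightarrow> nat" where
  "total_degree F = Max (monom_degree ` Poly_Mapping.keys F)"

definition homogeneous :: "poly3 \<Rightarrow> bool" where
  "homogeneous F \<longleftrightarrow> (\<exists>d. \<forall>m\<in>Poly_Mapping.keys F. monom_degree m = d)"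

definition eval_poly3 :: "poly3 \<Rightarrow> complex^3 \<Rightarrow> complex" where
  "eval_poly3 F x = (\<Sum>m\<in>Poly_Mapping.keys F.
     Poly_Mapping.lookup F m * (\<Prod>i\<in>UNIV. x $ i ^ Poly_Mapping.lookup m i))"

definition zero_locus :: "poly3 \<Rightarrow> cp2 set" where
  "zero_locus F = {p. eval_poly3 F (rep_cp2 p) = 0}"

definition defines_curve :: "poly3 \<Rightarrow> cp2 set \<Rightarrow> bool" where
  "defines_curve F D \<longleftrightarrow> irreducible F \<and> homogeneous F \<and> D = zero_locus F"

definition irreducible_curve :: "cp2 set \<Rightarrow> bool" where
  "irreducible_curve D \<longleftrightarrow> (\<exists>F. defines_curve F D)"

text \<open>The irreducible equation of a curve is unique up to a nonzero constant factor (by the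
  Nullstellensatz), so neither the degree nor the singular points depend on the choice made here.\<close>

definition curve_equation :: "cp2 set \<Rightarrow> poly3" where
  "curve_equation D = (SOME F. defines_curve F D)"

definition curve_degree :: "cp2 set \<Rightarrow> nat" where
  "curve_degree D = total_degree (curve_equation D)"

definition singular_point :: "cp2 set \<Rightarrow> cp2 \<Rightarrow> bool" where
  "singular_point D p \<longleftrightarrow>
     p \<in> D \<and> (eval_poly3 (curve_equation D) has_derivative (\<lambda>_. 0)) (at (rep_cp2 p))"

section \<open>Algebraic solutions\<close>

text \<open>Sections over \<open>W\<close> of the ideal sheaf of the reduced curve \<open>D\<close>.\<close>

definition ideal_sheaf :: "cp2 set \<Rightarrow> cp2 set \<Rightarrow> (cp2 \<Rightarrow> complex) set" where
  "ideal_sheaf D W = {f. holomorphic_P2 f W \<and> (\<forall>p \<in> D \<inter> W. f p = 0)}"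

definition invariant_by :: "(cp2 set \<times> vector_field) set \<Rightarrow> cp2 set \<Rightarrow> bool" where
  "invariant_by \<F> D \<longleftrightarrow>
     (\<forall>(U, X)\<in>\<F>. \<forall>W. open W \<and> W \<subseteq> U \<longrightarrow>
        (\<forall>f \<in> ideal_sheaf D W. vf_apply X f \<in> ideal_sheaf D W))"

definition irreducible_algebraic_solution ::
    "(cp2 set \<times> vector_field) set \<Rightarrow> cp2 set \<Rightarrow> bool" where
  "irreducible_algebraic_solution \<F> D \<longleftrightarrow> irreducible_curve D \<and> invariant_by \<F> D"

end

theory Submission
  imports Defs
begin

text \<open>A nonzero linear form has no singular zero. A quadratic form with a singular zero
  \<open>v \<noteq> 0\<close> has \<open>v\<close> in the kernel of its symmetric matrix, hence is a binary quadratic form in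
  suitable linear forms, and so splits into two linear factors over the complex numbers. It is
  therefore reducible.\<close>

section \<open>Polynomials in three variables\<close>

lemma monom_degree_0: "monom_degree m = 0 \<longleftrightarrow> m = 0"
  by (auto simp: monom_degree_def poly_mapping_eq_iff fun_eq_iff)

text \<open>Peels one variable off a monomial; one or two applications bring a monomial of degree
  one or two to a product of variables.\<close>

lemma monom_degree_SucE:
  assumes "monom_degree m = Suc d"
  obtains i m' where "m = Poly_Mapping.single i 1 + m'" "monom_degree m' = d"
proof -
  obtain i where i: "Poly_Mapping.lookup m i \<noteq> 0"
    using assms unfolding monom_degree_def by (metis nat.distinct(1) sum.neutral)
  define m' where "m' = m - Poly_Mapping.single i 1"
  have m: "m = Poly_Mapping.single i 1 + m'"
    unfolding m'_def
    by (rule poly_mapping_eqI) (use i in \<open>auto simp: lookup_add lookup_minus lookup_single when_def\<close>)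
  have "monom_degree m = 1 + monom_degree m'"
    unfolding m
    by (simp add: monom_degree_def lookup_add sum.distrib lookup_single when_def)
  then show ?thesis using that m assms by auto
qed

lemma total_degree_homogeneous:
  assumes "F \<noteq> 0" and "\<forall>m\<in>Poly_Mapping.keys F. monom_degree m = d"
  shows "total_degree F = d"
  using assms by (simp add: total_degree_def image_constant_conv cong: image_cong_simp)

text \<open>The summands \<open>F\<close>, \<open>G\<close> and \<open>F + G\<close> have different
  supports; summing over one common finite set is what makes evaluation visibly additive.\<close>

lemma eval_poly3_superset:
  assumes "finite S" "Poly_Mapping.keys F \<subseteq> S"
  shows "eval_poly3 F x =
    (\<Sum>m\<in>S. Poly_Mapping.lookup F m * (\<Prod>i\<in>UNIV. x $ i ^ Poly_Mapping.lookup m i))"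
  unfolding eval_poly3_def
  by (rule sum.mono_neutral_left) (use assms in \<open>auto simp: in_keys_iff\<close>)

lemma eval_poly3_0: "eval_poly3 0 x = 0"
  by (simp add: eval_poly3_def)

lemma eval_poly3_add: "eval_poly3 (F + G) x = eval_poly3 F x + eval_poly3 G x"
proof -
  let ?S = "Poly_Mapping.keys F \<union> Poly_Mapping.keys G"
  have S: "finite ?S" by simp
  show ?thesis
    unfolding eval_poly3_superset[OF S Poly_Mapping.keys_add]
      eval_poly3_superset[OF S Un_upper1] eval_poly3_superset[OF S Un_upper2]
    by (simp add: lookup_add algebra_simps sum.distrib)
qed

lemma eval_poly3_sum: "eval_poly3 (\<Sum>a\<in>A. F a) x = (\<Sum>a\<in>A. eval_poly3 (F a) x)"
  by (induction A rule: infinite_finite_induct) (simp_all add: eval_poly3_0 eval_poly3_add)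

lemma eval_poly3_single:
  "eval_poly3 (Poly_Mapping.single m c) x = c * (\<Prod>i\<in>UNIV. x $ i ^ Poly_Mapping.lookup m i)"
  by (subst eval_poly3_superset[of "{m}"]) (auto simp: lookup_single)

lemma poly_mapping_eq_sum_single:
  "F = (\<Sum>m\<in>Poly_Mapping.keys F. Poly_Mapping.single m (Poly_Mapping.lookup F m))"
  by (rule poly_mapping_eqI) (auto simp: lookup_sum lookup_single when_def in_keys_iff)

lemma single_sum:
  "Poly_Mapping.single m (\<Sum>a\<in>A. f a) = (\<Sum>a\<in>A. Poly_Mapping.single m (f a))"
  by (induction A rule: infinite_finite_induct) (simp_all add: single_add)

text \<open>The constant monomial occurs in 1, and exponents are natural numbers, so a product
  contains it only if both factors do.\<close>

lemma not_unit_poly3: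
  fixes L :: poly3
  assumes "0 \<notin> Poly_Mapping.keys L"
  shows "\<not> L dvd 1"
proof
  assume "L dvd 1"
  then obtain G where "1 = L * G" by (rule dvdE)
  then have "0 \<in> Poly_Mapping.keys (L * G)" by (metis keys_one singletonI)
  then obtain a b where "a \<in> Poly_Mapping.keys L" "0 = a + b"
    using keys_mult[of L G] by blast
  then have "a = 0" by (simp add: poly_mapping_eq_iff fun_eq_iff plus_poly_mapping.rep_eq)
  with assms \<open>a \<in> _\<close> show False by simp
qed

section \<open>Linear and quadratic forms\<close>

definition lin_form :: "(3 \<Rightarrow> complex) \<Rightarrow> poly3" where
  "lin_form l = (\<Sum>i\<in>UNIV. Poly_Mapping.single (Poly_Mapping.single i 1) (l i))"

text \<open>The matrix \<open>b\<close> may be asymmetric, so that a product of linear forms has the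
  coefficients \<open>l i * m j\<close> directly.\<close>

definition quad_form :: "(3 \<Rightarrow> 3 \<Rightarrow> complex) \<Rightarrow> poly3" where
  "quad_form b = (\<Sum>i\<in>UNIV. \<Sum>j\<in>UNIV.
     Poly_Mapping.single (Poly_Mapping.single i 1 + Poly_Mapping.single j 1) (b i j))"

lemma eval_variable:
  "(\<Prod>k\<in>UNIV. (x :: complex^3) $ k ^ Poly_Mapping.lookup (Poly_Mapping.single i 1) k) = x $ i"
  by (simp add: lookup_single when_def if_distrib[of "\<lambda>n. _ ^ n"] cong: if_cong)

lemma eval_lin_form: "eval_poly3 (lin_form l) x = (\<Sum>i\<in>UNIV. l i * x $ i)"
  by (simp add: lin_form_def eval_poly3_sum eval_poly3_single eval_variable[simplified])

lemma eval_quad_form: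
  "eval_poly3 (quad_form b) x = (\<Sum>i\<in>UNIV. \<Sum>j\<in>UNIV. b i j * (x $ i * x $ j))"
  by (simp add: quad_form_def eval_poly3_sum eval_poly3_single lookup_add power_add prod.distrib
      eval_variable[simplified])

lemma lin_form_sum: "lin_form (\<lambda>i. \<Sum>a\<in>A. l a i) = (\<Sum>a\<in>A. lin_form (l a))"
  unfolding lin_form_def single_sum by (rule sum.swap)

lemma quad_form_sum: "quad_form (\<lambda>i j. \<Sum>a\<in>A. b a i j) = (\<Sum>a\<in>A. quad_form (b a))"
  unfolding quad_form_def single_sum sum.swap[of _ A] by (rule refl)

lemma lin_form_zero: "lin_form (\<lambda>_. 0) = 0"
  by (simp add: lin_form_def)

lemma lin_form_not_unit: "\<not> lin_form l dvd 1"
proof (rule not_unit_poly3)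
  have "Poly_Mapping.single i (1::nat) \<noteq> 0" for i :: 3
    by (metis lookup_single_eq lookup_zero zero_neq_one)
  then show "0 \<notin> Poly_Mapping.keys (lin_form l)"
    by (simp add: lin_form_def in_keys_iff lookup_sum lookup_single)
qed

lemma lin_form_times: "lin_form l * lin_form m = quad_form (\<lambda>i j. l i * m j)"
  by (simp add: lin_form_def quad_form_def sum_product mult_single)

text \<open>The positions (i, j) and (j, i) carry the same monomial, so only the sum of their two
  coefficients matters.\<close>

lemma quad_form_symmetrize: "quad_form b = quad_form (\<lambda>i j. (b i j + b j i) / 2)"
proof -
  have half: "quad_form (\<lambda>i j. b i j / 2) = quad_form (\<lambda>i j. b j i / 2)"
    unfolding quad_form_def by (subst sum.swap) (simp add: add.commute)
  have "quad_form (\<lambda>i j. (b i j + b j i) / 2)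
      = quad_form (\<lambda>i j. b i j / 2) + quad_form (\<lambda>i j. b j i / 2)"
    by (simp add: quad_form_def add_divide_distrib single_add sum.distrib)
  also have "\<dots> = quad_form (\<lambda>i j. b i j / 2) + quad_form (\<lambda>i j. b i j / 2)"
    by (simp only: half)
  also have "\<dots> = quad_form b"
    by (simp add: quad_form_def flip: sum.distrib single_add)
  finally show ?thesis ..
qed

text \<open>Each term is a multiple of a single variable; the linear forms chosen term by term are
  added up with \<open>lin_form_sum\<close>.\<close>

lemma homogeneous_1_eq_lin_form:
  assumes "\<forall>m\<in>Poly_Mapping.keys F. monom_degree m = 1"
  shows "\<exists>l. F = lin_form l"
proof -
  have "\<exists>l. Poly_Mapping.single m c = lin_form l" if "monom_degree m = 1" for m c
  proof -
    from that obtain i where "m = Poly_Mapping.single i 1"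
      by (metis monom_degree_SucE monom_degree_0 One_nat_def add.right_neutral)
    then have "Poly_Mapping.single m c = lin_form (\<lambda>i'. if i' = i then c else 0)"
      by (simp add: lin_form_def if_distrib[of "Poly_Mapping.single _"] cong: if_cong)
    then show ?thesis by blast
  qed
  then have "\<forall>m\<in>Poly_Mapping.keys F. \<exists>l.
      Poly_Mapping.single m (Poly_Mapping.lookup F m) = lin_form l"
    using assms by blast
  from bchoice[OF this] obtain l where l: "\<forall>m\<in>Poly_Mapping.keys F.
      Poly_Mapping.single m (Poly_Mapping.lookup F m) = lin_form (l m)"
    by blast
  have "F = (\<Sum>m\<in>Poly_Mapping.keys F. lin_form (l m))"
    by (rule trans[OF poly_mapping_eq_sum_single]) (simp add: l)
  also note lin_form_sum[symmetric]
  finally show ?thesis by blast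
qed

lemma homogeneous_2_eq_quad_form:
  assumes "\<forall>m\<in>Poly_Mapping.keys F. monom_degree m = 2"
  shows "\<exists>b. F = quad_form b"
proof -
  have "\<exists>b. Poly_Mapping.single m c = quad_form b" if "monom_degree m = 2" for m c
  proof -
    from that obtain i j where "m = Poly_Mapping.single i 1 + Poly_Mapping.single j 1"
      by (metis monom_degree_SucE monom_degree_0 One_nat_def add.right_neutral numeral_2_eq_2)
    \<comment> \<open>The test on \<open>j'\<close> comes first so that the inner sum, which runs
      over the second index, collapses before the outer one.\<close>
    then have "Poly_Mapping.single m c =
        quad_form (\<lambda>i' j'. if j' = j then if i' = i then c else 0 else 0)"
      by (simp add: quad_form_def if_distrib[of "Poly_Mapping.single _"] cong: if_cong)
    then show ?thesis by blast
  qed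
  then have "\<forall>m\<in>Poly_Mapping.keys F. \<exists>b.
      Poly_Mapping.single m (Poly_Mapping.lookup F m) = quad_form b"
    using assms by blast
  from bchoice[OF this] obtain b where b: "\<forall>m\<in>Poly_Mapping.keys F.
      Poly_Mapping.single m (Poly_Mapping.lookup F m) = quad_form (b m)"
    by blast
  have "F = (\<Sum>m\<in>Poly_Mapping.keys F. quad_form (b m))"
    by (rule trans[OF poly_mapping_eq_sum_single]) (simp add: b)
  also note quad_form_sum[symmetric]
  finally show ?thesis by blast
qed

section \<open>Factorization of binary quadratic forms and of singular symmetric matrices\<close>

lemma binary_quadratic_splits:
  fixes A B C :: complex
  shows "\<exists>\<alpha> \<beta> \<gamma> \<delta>. A = \<alpha> * \<gamma> \<and> 2 * B = \<alpha> * \<delta> + \<beta> * \<gamma> \<and> C = \<beta> * \<delta>"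
proof (cases "A = 0")
  case True
  \<comment> \<open>The goal is to write A x^2 + 2 B x y + C y^2 as (\<alpha> x + \<beta> y)
    (\<gamma> x + \<delta> y). For A = 0 the factor y splits off.\<close>
  then have "A = 0 * (2 * B) \<and> 2 * B = 0 * C + 1 * (2 * B) \<and> C = 1 * C" by simp
  then show ?thesis by blast
next
  case False
  \<comment> \<open>A root of the reduced discriminant, as in the quadratic formula.\<close>
  define r where "r = csqrt (B\<^sup>2 - A * C)"
  have "r\<^sup>2 = B\<^sup>2 - A * C" by (simp add: r_def)
  then have "C = (B + r) * ((B - r) / A)"
    using False by (simp add: field_simps power2_eq_square)
  with False have "A = A * 1 \<and> 2 * B = A * ((B - r) / A) + (B + r) * 1 \<and> C = (B + r) * ((B - r) / A)"
    by simp
  then show ?thesis by blast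
qed

lemma ex_other_indices: "\<exists>p q. p \<noteq> q \<and> p \<noteq> k \<and> q \<noteq> k \<and> (UNIV :: 3 set) = {p, q, k}"
proof -
  have "card (- {k}) = 2" by (simp add: Compl_eq_Diff_UNIV card_Diff_singleton)
  then obtain p q where "p \<noteq> q" "- {k} = {p, q}" by (auto simp: card_2_iff)
  then show ?thesis by blast
qed

text \<open>The form descends to the quotient by \<open>v\<close>. As
  \<open>v $ k \<noteq> 0\<close> for some \<open>k\<close>, the other two unit vectors give a basis
  there; the binary form splits, and its factors are pulled back.\<close>

lemma symmetric_singular_matrix_splits:
  fixes a :: "3 \<Rightarrow> 3 \<Rightarrow> complex" and v :: "complex^3"
  assumes sym: "\<And>i j. a i j = a j i" and ker: "\<And>i. (\<Sum>j\<in>UNIV. a i j * v $ j) = 0" and "v \<noteq> 0"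
  shows "\<exists>l m. \<forall>i j. a i j = (l i * m j + l j * m i) / 2"
proof -
  obtain k where k: "v $ k \<noteq> 0" using \<open>v \<noteq> 0\<close> by (auto simp: vec_eq_iff)
  obtain p q where pq: "p \<noteq> q" "p \<noteq> k" "q \<noteq> k" and U: "(UNIV :: 3 set) = {p, q, k}"
    using ex_other_indices by blast
  obtain \<alpha> \<beta> \<gamma> \<delta> where split: "a p p = \<alpha> * \<gamma>" "2 * a p q = \<alpha> * \<delta> + \<beta> * \<gamma>" "a q q = \<beta> * \<delta>"
    using binary_quadratic_splits by metis
  \<comment> \<open>The entries at \<open>k\<close> are forced by the requirement that both linear
    forms vanish at \<open>v\<close>.\<close>
  define l where "l i = (if i = p then \<alpha> else if i = q then \<beta> else - (\<alpha> * v $ p + \<beta> * v $ q) / v $ k)" for i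
  define m where "m i = (if i = p then \<gamma> else if i = q then \<delta> else - (\<gamma> * v $ p + \<delta> * v $ q) / v $ k)" for i
  \<comment> \<open>The symmetric matrix of the product of the two forms. It shares with
    \<open>a\<close> the symmetry, the kernel vector \<open>v\<close> and the block at
    \<open>p\<close>, \<open>q\<close>; these determine all entries.\<close>
  define c where "c i j = (l i * m j + l j * m i) / 2" for i j
  have csym: "c i j = c j i" for i j by (simp add: c_def)
  have "(\<Sum>j\<in>UNIV. l j * v $ j) = 0" "(\<Sum>j\<in>UNIV. m j * v $ j) = 0"
    using pq k by (simp_all add: U l_def m_def)
  moreover have "(\<Sum>j\<in>UNIV. c i j * v $ j)
      = (l i * (\<Sum>j\<in>UNIV. m j * v $ j) + m i * (\<Sum>j\<in>UNIV. l j * v $ j)) / 2" for i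
    by (simp add: c_def sum_distrib_left sum.distrib[symmetric] sum_divide_distrib algebra_simps)
  ultimately have cker: "(\<Sum>j\<in>UNIV. c i j * v $ j) = 0" for i by simp
  have eq: "a p p = c p p" "a p q = c p q" "a q q = c q q"
    using split pq by (simp_all add: c_def l_def m_def field_simps)
  \<comment> \<open>A row with \<open>v\<close> in its kernel is determined by its entries at \<open>p\<close> and \<open>q\<close>.\<close>
  have col: "a i k = c i k" if "a i p = c i p" "a i q = c i q" for i
  proof -
    have "a i p * v $ p + (a i q * v $ q + a i k * v $ k) = 0"
      "c i p * v $ p + (c i q * v $ q + c i k * v $ k) = 0"
      using ker[of i] cker[of i] pq by (simp_all add: U)
    then have "a i k * v $ k = c i k * v $ k"
      using that by (metis add_left_cancel)
    then show ?thesis using k by simp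
  qed
  \<comment> \<open>Agreement spreads from the block to column \<open>k\<close> by
    \<open>col\<close>, to row \<open>k\<close> by symmetry, and to the corner by \<open>col\<close>
    again.\<close>
  have qp: "a q p = c q p" using eq(2) sym[of p q] csym[of p q] by simp
  have pk: "a p k = c p k" and qk: "a q k = c q k" using eq qp by (simp_all add: col)
  have kp: "a k p = c k p" and kq: "a k q = c k q"
    using pk qk sym[of k] csym[of k] by simp_all
  have kk: "a k k = c k k" using kp kq by (rule col)
  have "\<forall>i\<in>{p, q, k}. \<forall>j\<in>{p, q, k}. a i j = c i j"
    using eq qp pk qk kp kq kk by blast
  then have "a i j = c i j" for i j
    unfolding U[symmetric] by blast
  then show ?thesis unfolding c_def by blast
qed

section \<open>Singular zeros of forms of low degree\<close>

text \<open>A linear form is its own derivative, and its values at the unit vectors are its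
  coefficients.\<close>

lemma lin_form_singular_zero:
  assumes "(eval_poly3 (lin_form l) has_derivative (\<lambda>_. 0)) (at v)"
  shows "lin_form l = 0"
proof -
  have "(eval_poly3 (lin_form l) has_derivative (\<lambda>h. \<Sum>i\<in>UNIV. l i * h $ i)) (at v)"
    unfolding eval_lin_form[abs_def]
    by (intro has_derivative_sum has_derivative_mult_right bounded_linear_imp_has_derivative
        bounded_linear_vec_nth)
  from has_derivative_unique[OF this assms]
  have "(\<Sum>i\<in>UNIV. l i * h $ i) = 0" for h by (rule fun_cong)
  from this[of "axis _ 1"] have "l i = 0" for i
    by (simp add: axis_def if_distrib[of "(*) _"] cong: if_cong)
  then have "l = (\<lambda>_. 0)" by (rule ext)
  then show ?thesis by (simp add: lin_form_zero)
qed

text \<open>For the symmetrized matrix \<open>a\<close>, the derivative at \<open>v\<close> in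
  direction \<open>h\<close> is twice the pairing of \<open>h\<close> with \<open>a\<close> applied
  to \<open>v\<close>. Its vanishing puts \<open>v\<close> into the kernel of
  \<open>a\<close>.\<close>

lemma quad_form_singular_zero:
  assumes "(eval_poly3 (quad_form b) has_derivative (\<lambda>_. 0)) (at v)" and "v \<noteq> 0"
  shows "\<exists>l m. quad_form b = lin_form l * lin_form m"
proof -
  define a where "a i j = (b i j + b j i) / 2" for i j
  have sym: "a i j = a j i" for i j by (simp add: a_def)
  have ba: "quad_form b = quad_form a"
    unfolding a_def by (rule quad_form_symmetrize)
  have "(eval_poly3 (quad_form b) has_derivative
      (\<lambda>h. \<Sum>i\<in>UNIV. \<Sum>j\<in>UNIV. a i j * (v $ i * h $ j + h $ i * v $ j))) (at v)"
    unfolding ba eval_quad_form[abs_def]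
    by (auto intro!: derivative_eq_intros bounded_linear_imp_has_derivative
        bounded_linear_vec_nth)
  from has_derivative_unique[OF this assms(1)]
  have *: "(\<Sum>i\<in>UNIV. \<Sum>j\<in>UNIV. a i j * (v $ i * h $ j + h $ i * v $ j)) = 0" for h
    by (rule fun_cong)
  have "(\<Sum>j\<in>UNIV. a k j * v $ j) = 0" for k
  proof -
    have "(\<Sum>i\<in>UNIV. \<Sum>j\<in>UNIV. a i j * (v $ i * h $ j + h $ i * v $ j))
        = 2 * (\<Sum>i\<in>UNIV. h $ i * (\<Sum>j\<in>UNIV. a i j * v $ j))" for h :: "complex^3"
    proof -
      \<comment> \<open>Symmetry of \<open>a\<close> makes the two halves of the product rule
        equal.\<close>
      have "(\<Sum>i\<in>UNIV. \<Sum>j\<in>UNIV. a i j * (v $ i * h $ j))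
          = (\<Sum>i\<in>UNIV. \<Sum>j\<in>UNIV. a i j * (h $ i * v $ j))"
        by (subst sum.swap, subst sym) (simp add: mult.commute)
      then show ?thesis
        by (simp add: distrib_left sum.distrib sum_distrib_left mult.left_commute)
    qed
    from this[of "axis k 1"] *[of "axis k 1"]
    have "(\<Sum>i\<in>UNIV. axis k 1 $ i * (\<Sum>j\<in>UNIV. a i j * v $ j)) = 0" by simp
    moreover have "axis k 1 $ i * c = (if i = k then c else 0)" for i and c :: complex
      by (simp add: axis_def)
    ultimately show ?thesis by simp
  qed
  from symmetric_singular_matrix_splits[OF sym this \<open>v \<noteq> 0\<close>]
  obtain l m where "a = (\<lambda>i j. (l i * m j + l j * m i) / 2)" by blast
  \<comment> \<open>Symmetrizing the coefficients \<open>l i * m j\<close> of the product yields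
    exactly \<open>a\<close>.\<close>
  then have "quad_form a = lin_form l * lin_form m"
    unfolding lin_form_times quad_form_symmetrize[of "\<lambda>i j. l i * m j"] by simp
  then show ?thesis using ba by auto
qed

text \<open>A constant is zero or a unit.\<close>

lemma constant_not_irreducible:
  assumes "\<forall>m\<in>Poly_Mapping.keys F. monom_degree m = 0"
  shows "\<not> irreducible (F :: poly3)"
proof
  assume irr: "irreducible F"
  define c where "c = Poly_Mapping.lookup F 0"
  have F: "F = Poly_Mapping.single 0 c"
    by (rule poly_mapping_eqI)
      (use assms in \<open>auto simp: c_def lookup_single when_def in_keys_iff monom_degree_0\<close>)
  then have "c \<noteq> 0" using irr by auto
  then have "1 = F * Poly_Mapping.single 0 (1 / c)" by (simp add: F mult_single)
  then have "F dvd 1" by (rule dvdI)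
  with irr show False by (simp add: irreducible_def)
qed

text \<open>The condition \<open>v \<noteq> 0\<close> matters in degree two: the derivative of every
  quadratic form vanishes at the origin.\<close>

lemma irreducible_form_singular_zero_degree:
  assumes irr: "irreducible F" and hom: "homogeneous F" and "v \<noteq> 0"
    and sing: "(eval_poly3 F has_derivative (\<lambda>_. 0)) (at v)"
  shows "total_degree F \<ge> 3"
proof (rule ccontr)
  assume low: "\<not> total_degree F \<ge> 3"
  have "F \<noteq> 0" using irr by auto
  moreover obtain d where d: "\<forall>m\<in>Poly_Mapping.keys F. monom_degree m = d"
    using hom by (auto simp: homogeneous_def)
  ultimately have "d = 0 \<or> d = 1 \<or> d = 2"
    using low total_degree_homogeneous[of F d] by auto
  then show False
  proof (elim disjE)
    assume "d = 0"
    with d irr constant_not_irreducible show False by blast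
  next
    assume "d = 1"
    with d obtain l where "F = lin_form l" using homogeneous_1_eq_lin_form by blast
    with sing lin_form_singular_zero \<open>F \<noteq> 0\<close> show False by blast
  next
    assume "d = 2"
    with d obtain b where "F = quad_form b" using homogeneous_2_eq_quad_form by blast
    with sing quad_form_singular_zero \<open>v \<noteq> 0\<close> obtain l m where "F = lin_form l * lin_form m"
      by blast
    with irr show False using irreducibleD lin_form_not_unit by blast
  qed
qed

theorem corollary4p5:
  fixes \<F> :: "(cp2 set \<times> vector_field) set" and D :: "cp2 set"
  assumes "foliation \<F>"
    and "irreducible_algebraic_solution \<F> D"
    and "\<exists>p. singular_point D p"
  shows "curve_degree D \<ge> 3"
proof -
  obtain p where "(eval_poly3 (curve_equation D) has_derivative (\<lambda>_. 0)) (at (rep_cp2 p))"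
    using assms(3) by (auto simp: singular_point_def)
  \<comment> \<open>An irreducible curve has some irreducible equation, so the choice in
    \<open>curve_equation\<close> is a genuine one.\<close>
  moreover have "defines_curve (curve_equation D) D"
    using assms(2) unfolding irreducible_algebraic_solution_def irreducible_curve_def
      curve_equation_def by (elim conjE) (rule someI_ex)
  \<comment> \<open>Representatives lie in the domain of the partial equivalence
    \<open>proj_rel\<close>, which excludes the origin.\<close>
  moreover have "rep_cp2 p \<noteq> 0"
    using Quotient_rep_reflp[OF Quotient_cp2, of p] by (simp add: proj_rel_def)
  ultimately show ?thesis
    unfolding curve_degree_def defines_curve_def
    using irreducible_form_singular_zero_degree by blast
qed

end
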